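(* Let $\psi\in L^2(\mathbb{R})$ be a wavelet, with associated subspaces $V_0=\overline{\operatorname{span}}\{D^mT^l\psi: m<0,\ l\in\mathbb{Z}\}$ and $W_0=\overline{\operatorname{span}}\{T^l\psi: l\in\mathbb{Z}\}$, and let $n\ge 0$ be an integer. Then $V_0$ is invariant under the action of $\mathcal{G}_n=\{T_{m/2^n}: m\in\mathbb{Z}\}$ if and only if $W_0$ is invariant under the action of $\mathcal{G}_n$.
   Context: On $L^2(\mathbb{R})$ define the unitary operators $Df(x)=\sqrt{2}\,f(2x)$, $T_\alpha f(x)=f(x-\alpha)$ for $\alpha\in\mathbb{R}$, and $T=T_1$. A function $\psi\in L^2(\mathbb{R})$ is a wavelet if $\{D^nT^l\psi: n,l\in\mathbb{Z}\}$ is an orthonormal basis of $L^2(\mathbb{R})$. The space $V_0$ is called the core space of $\psi$. A closed subspace is invariant under a group of operators if every operator of the group maps the subspace into itself. *)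

theory Defs
  imports "HOL-Analysis.Analysis"
begin

definition square_integrable :: "(real \<Rightarrow> complex) \<Rightarrow> bool" where
  "square_integrable f \<longleftrightarrow>
     f \<in> borel_measurable lebesgue \<and> integrable lebesgue (\<lambda>x. (cmod (f x))\<^sup>2)"

lemma square_integrable_measurable:
  "square_integrable f \<Longrightarrow> f \<in> borel_measurable lebesgue"
  by (simp add: square_integrable_def)

lemma square_integrable_zero: "square_integrable (\<lambda>x. 0)"
  by (simp add: square_integrable_def)

lemma square_integrable_scale:
  assumes "square_integrable f"
  shows "square_integrable (\<lambda>x. c * f x)"
proof -
  note [measurable] = square_integrable_measurable[OF assms]
  have "(\<lambda>x. c * f x) \<in> borel_measurable lebesgue"
    by measurable
  then show ?thesis
    using assms by (simp add: square_integrable_def norm_mult power_mult_distrib)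
qed

lemma square_integrable_add:
  assumes f: "square_integrable f" and g: "square_integrable g"
  shows "square_integrable (\<lambda>x. f x + g x)"
proof -
  note [measurable] = square_integrable_measurable[OF f] square_integrable_measurable[OF g]
  have "integrable lebesgue (\<lambda>x. 2 * (cmod (f x))\<^sup>2 + 2 * (cmod (g x))\<^sup>2)"
    using f g by (simp add: square_integrable_def)
  then have "integrable lebesgue (\<lambda>x. (cmod (f x + g x))\<^sup>2)"
  proof (rule Bochner_Integration.integrable_bound)
    show "AE x in lebesgue. norm ((cmod (f x + g x))\<^sup>2) \<le> norm (2 * (cmod (f x))\<^sup>2 + 2 * (cmod (g x))\<^sup>2)"
    proof (rule AE_I2)
      fix x
      have "(cmod (f x + g x))\<^sup>2 \<le> (cmod (f x) + cmod (g x))\<^sup>2"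
        by (intro power_mono norm_triangle_ineq norm_ge_zero)
      also have "\<dots> \<le> 2 * (cmod (f x))\<^sup>2 + 2 * (cmod (g x))\<^sup>2"
        using sum_squares_bound[of "cmod (f x)" "cmod (g x)"] by (simp add: power2_sum)
      finally show "norm ((cmod (f x + g x))\<^sup>2) \<le> norm (2 * (cmod (f x))\<^sup>2 + 2 * (cmod (g x))\<^sup>2)"
        by simp
    qed
  qed measurable
  then show ?thesis
    by (simp add: square_integrable_def)
qed

lemma square_integrable_uminus:
  assumes "square_integrable f"
  shows "square_integrable (\<lambda>x. - f x)"
  using square_integrable_scale[OF assms, of "-1"] by simp

lemma square_integrable_diff:
  assumes "square_integrable f" "square_integrable g"
  shows "square_integrable (\<lambda>x. f x - g x)"
  using square_integrable_add[OF assms(1) square_integrable_uminus[OF assms(2)]] by simp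

lemma square_integrable_affine:
  assumes f: "square_integrable f" and "c \<noteq> 0"
  shows "square_integrable (\<lambda>x. f (t + c * x))"
  using f borel_measurable_affine[of f c t]
    lebesgue_integrable_real_affine[of "\<lambda>x. (cmod (f x))\<^sup>2" c t] \<open>c \<noteq> 0\<close>
  by (simp add: square_integrable_def)

lemma integrable_mult_cnj:
  assumes f: "square_integrable f" and g: "square_integrable g"
  shows "integrable lebesgue (\<lambda>x. f x * cnj (g x))"
proof -
  note [measurable] = square_integrable_measurable[OF f] square_integrable_measurable[OF g]
  have "integrable lebesgue (\<lambda>x. (cmod (f x))\<^sup>2 + (cmod (g x))\<^sup>2)"
    using f g by (simp add: square_integrable_def)
  then show ?thesis
  proof (rule Bochner_Integration.integrable_bound)
    show "AE x in lebesgue. norm (f x * cnj (g x)) \<le> norm ((cmod (f x))\<^sup>2 + (cmod (g x))\<^sup>2)"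
    proof (rule AE_I2)
      fix x
      have "0 \<le> cmod (f x) * cmod (g x)" by simp
      then show "norm (f x * cnj (g x)) \<le> norm ((cmod (f x))\<^sup>2 + (cmod (g x))\<^sup>2)"
        using sum_squares_bound[of "cmod (f x)" "cmod (g x)"] by (simp add: norm_mult, linarith)
    qed
    have "(\<lambda>x. cnj (g x)) \<in> borel_measurable lebesgue"
      by (rule borel_measurable_continuous_on[OF continuous_on_cnj[OF continuous_on_id]]) measurable
    then show "(\<lambda>x. f x * cnj (g x)) \<in> borel_measurable lebesgue"
      by measurable
  qed
qed

lemma AE_lebesgue_affine:
  fixes c t :: real
  assumes ae: "AE x in lebesgue. P x" and "c \<noteq> 0"
  shows "AE x in lebesgue. P (t + c * x)"
proof -
  have m: "(\<lambda>x. t + c * x) \<in> lebesgue \<rightarrow>\<^sub>M lebesgue"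
    using lebesgue_affine_measurable[where c = "\<lambda>x::real. c" and t = t] \<open>c \<noteq> 0\<close> by simp
  have "AE x in density (distr lebesgue lebesgue (\<lambda>x. t + c * x)) (\<lambda>_. ennreal \<bar>c\<bar>). P x"
    using ae by (subst (asm) lebesgue_real_affine[OF \<open>c \<noteq> 0\<close>, of t])
  then have "AE x in distr lebesgue lebesgue (\<lambda>x. t + c * x). P x"
    using \<open>c \<noteq> 0\<close> by (simp add: AE_density)
  then show ?thesis
    by (rule AE_distrD[OF m])
qed

(* Partial equivalence: only square-integrable functions are represented, and two of them are
   identified iff they agree almost everywhere. *)
quotient_type L2 = "real \<Rightarrow> complex" /
  partial: "\<lambda>f g. square_integrable f \<and> square_integrable g \<and> (AE x in lebesgue. f x = g x)"
proof (rule part_equivpI)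
  show "\<exists>f. square_integrable f \<and> square_integrable f \<and> (AE x in lebesgue. f x = f x)"
    using square_integrable_zero by auto
  show "symp (\<lambda>f g. square_integrable f \<and> square_integrable g \<and> (AE x in lebesgue. f x = g x))"
    by (auto intro!: sympI elim: eventually_mono)
  show "transp (\<lambda>f g. square_integrable f \<and> square_integrable g \<and> (AE x in lebesgue. f x = g x))"
    by (auto intro!: transpI elim: eventually_elim2)
qed

lift_definition scaleC :: "complex \<Rightarrow> L2 \<Rightarrow> L2" is "\<lambda>c f x. c * f x"
  by (auto intro: square_integrable_scale elim: eventually_mono)

lift_definition cinner :: "L2 \<Rightarrow> L2 \<Rightarrow> complex" is "\<lambda>f g. LINT x|lebesgue. f x * cnj (g x)"
  by (intro integral_cong_AE borel_measurable_integrable integrable_mult_cnj)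
     (auto elim: eventually_elim2)

instantiation L2 :: ab_group_add
begin

lift_definition zero_L2 :: L2 is "\<lambda>x. 0"
  by (simp add: square_integrable_zero)

lift_definition plus_L2 :: "L2 \<Rightarrow> L2 \<Rightarrow> L2" is "\<lambda>f g x. f x + g x"
  by (auto intro: square_integrable_add elim: eventually_elim2)

lift_definition uminus_L2 :: "L2 \<Rightarrow> L2" is "\<lambda>f x. - f x"
  by (auto intro: square_integrable_uminus elim: eventually_mono)

lift_definition minus_L2 :: "L2 \<Rightarrow> L2 \<Rightarrow> L2" is "\<lambda>f g x. f x - g x"
  by (auto intro: square_integrable_diff elim: eventually_elim2)

instance
proof
  fix f g h :: L2
  show "f + g + h = f + (g + h)"
    by transfer (auto simp: add.assoc intro: square_integrable_add)
  show "f + g = g + f"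
    by transfer (auto simp: add.commute intro: square_integrable_add)
  show "0 + f = f"
    by transfer auto
  show "- f + f = 0"
    by transfer (auto simp: square_integrable_zero)
  show "f - g = f + - g"
    by transfer (auto intro: square_integrable_diff)
qed

end

lemma scaleC_add_right: "scaleC a (f + g) = scaleC a f + scaleC a g"
  by transfer (auto simp: distrib_left intro!: square_integrable_scale square_integrable_add)

lemma scaleC_add_left: "scaleC (a + b) f = scaleC a f + scaleC b f"
  by transfer (auto simp: distrib_right intro!: square_integrable_scale square_integrable_add)

lemma scaleC_scaleC: "scaleC a (scaleC b f) = scaleC (a * b) f"
  by transfer (auto simp: mult.assoc intro!: square_integrable_scale)

lemma scaleC_one: "scaleC 1 f = f"
  by transfer auto

global_interpretation complex_L2: vector_space scaleC
  defines cspan = complex_L2.span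
  by standard (simp_all add: scaleC_add_right scaleC_add_left scaleC_scaleC scaleC_one)

lemma cinner_commute: "cinner f g = cnj (cinner g f)"
  by transfer (simp add: mult.commute flip: Bochner_Integration.integral_cnj)

lemma cinner_add_left: "cinner (f + g) h = cinner f h + cinner g h"
  by transfer (simp add: distrib_right integrable_mult_cnj)

lemma cinner_scaleC_left: "cinner (scaleC c f) g = c * cinner f g"
  by transfer (simp add: mult.assoc)

lemma cinner_self_eq_integral:
  "(LINT x|lebesgue. f x * cnj (f x)) = complex_of_real (LINT x|lebesgue. (cmod (f x))\<^sup>2)"
  by (simp add: complex_norm_square[symmetric] flip: integral_complex_of_real)

instantiation L2 :: real_vector
begin

definition scaleR_L2 :: "real \<Rightarrow> L2 \<Rightarrow> L2" where
  "scaleR_L2 r f = scaleC (complex_of_real r) f"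

instance
proof
  fix a b :: real and f g :: L2
  show "a *\<^sub>R (f + g) = a *\<^sub>R f + a *\<^sub>R g"
    by (simp add: scaleR_L2_def scaleC_add_right)
  show "(a + b) *\<^sub>R f = a *\<^sub>R f + b *\<^sub>R f"
    by (simp add: scaleR_L2_def scaleC_add_left)
  show "a *\<^sub>R b *\<^sub>R f = (a * b) *\<^sub>R f"
    by (simp add: scaleR_L2_def scaleC_scaleC)
  show "1 *\<^sub>R f = f"
    by (simp add: scaleR_L2_def scaleC_one)
qed

end

(* The type class needs a real inner product; it is Re o cinner and induces the usual L2 norm.
   Spans and orthonormality below are over the complex numbers. *)
instantiation L2 :: real_inner
begin

lift_definition norm_L2 :: "L2 \<Rightarrow> real" is "\<lambda>f. sqrt (LINT x|lebesgue. (cmod (f x))\<^sup>2)"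
proof -
  fix f g :: "real \<Rightarrow> complex"
  assume fg: "square_integrable f \<and> square_integrable g \<and> (AE x in lebesgue. f x = g x)"
  then have "(LINT x|lebesgue. (cmod (f x))\<^sup>2) = (LINT x|lebesgue. (cmod (g x))\<^sup>2)"
    by (intro integral_cong_AE) (auto simp: square_integrable_def elim: eventually_mono)
  then show "sqrt (LINT x|lebesgue. (cmod (f x))\<^sup>2) = sqrt (LINT x|lebesgue. (cmod (g x))\<^sup>2)"
    by simp
qed

definition inner_L2 :: "L2 \<Rightarrow> L2 \<Rightarrow> real" where
  "inner_L2 f g = Re (cinner f g)"

definition sgn_L2 :: "L2 \<Rightarrow> L2" where
  "sgn_L2 f = f /\<^sub>R norm f"

definition dist_L2 :: "L2 \<Rightarrow> L2 \<Rightarrow> real" where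
  "dist_L2 f g = norm (f - g)"

definition uniformity_L2 :: "(L2 \<times> L2) filter" where
  "uniformity_L2 = (INF e\<in>{0<..}. principal {(f, g). dist f g < e})"

definition open_L2 :: "L2 set \<Rightarrow> bool" where
  "open_L2 U \<longleftrightarrow> (\<forall>f\<in>U. eventually (\<lambda>(f', g). f' = f \<longrightarrow> g \<in> U) uniformity)"

instance
proof
  fix r :: real and f g h :: L2 and U :: "L2 set"
  show "sgn f = f /\<^sub>R norm f"
    by (rule sgn_L2_def)
  show "dist f g = norm (f - g)"
    by (rule dist_L2_def)
  show "uniformity = (INF e\<in>{0<..}. principal {(f, g :: L2). dist f g < e})"
    by (rule uniformity_L2_def)
  show "open U \<longleftrightarrow> (\<forall>f\<in>U. eventually (\<lambda>(f', g). f' = f \<longrightarrow> g \<in> U) uniformity)"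
    by (rule open_L2_def)
  show "inner f g = inner g f"
    unfolding inner_L2_def by (subst cinner_commute) simp
  show "inner (f + g) h = inner f h + inner g h"
    by (simp add: inner_L2_def cinner_add_left)
  show "inner (r *\<^sub>R f) g = r * inner f g"
    by (simp add: inner_L2_def scaleR_L2_def cinner_scaleC_left)
  show "0 \<le> inner f f"
    unfolding inner_L2_def by transfer (simp add: cinner_self_eq_integral)
  show "inner f f = 0 \<longleftrightarrow> f = 0"
    unfolding inner_L2_def
    by transfer (auto simp: cinner_self_eq_integral square_integrable_zero square_integrable_def
        integral_nonneg_eq_0_iff_AE)
  show "norm f = sqrt (inner f f)"
    unfolding inner_L2_def by transfer (simp add: cinner_self_eq_integral)
qed

end


lift_definition dilation :: "L2 \<Rightarrow> L2" is "\<lambda>f x. complex_of_real (sqrt 2) * f (2 * x)"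
proof -
  fix f g :: "real \<Rightarrow> complex"
  assume fg: "square_integrable f \<and> square_integrable g \<and> (AE x in lebesgue. f x = g x)"
  then show "square_integrable (\<lambda>x. complex_of_real (sqrt 2) * f (2 * x)) \<and>
      square_integrable (\<lambda>x. complex_of_real (sqrt 2) * g (2 * x)) \<and>
      (AE x in lebesgue. complex_of_real (sqrt 2) * f (2 * x) = complex_of_real (sqrt 2) * g (2 * x))"
    using square_integrable_affine[of f 2 0] square_integrable_affine[of g 2 0]
      AE_lebesgue_affine[of "\<lambda>x. f x = g x" 2 0]
    by (auto intro: square_integrable_scale)
qed

lift_definition translation :: "real \<Rightarrow> L2 \<Rightarrow> L2" is "\<lambda>\<alpha> f x. f (x - \<alpha>)"
proof -
  fix \<alpha> :: real and f g :: "real \<Rightarrow> complex"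
  assume fg: "square_integrable f \<and> square_integrable g \<and> (AE x in lebesgue. f x = g x)"
  then show "square_integrable (\<lambda>x. f (x - \<alpha>)) \<and> square_integrable (\<lambda>x. g (x - \<alpha>)) \<and>
      (AE x in lebesgue. f (x - \<alpha>) = g (x - \<alpha>))"
    using square_integrable_affine[of f 1 "- \<alpha>"] square_integrable_affine[of g 1 "- \<alpha>"]
      AE_lebesgue_affine[of "\<lambda>x. f x = g x" 1 "- \<alpha>"]
    by auto
qed

(* Integer powers of an operator; negative powers are powers of the inverse function, so this is
   the group-theoretic power only for bijections (see bij_dilation and bij_translation). *)
definition int_pow :: "('a \<Rightarrow> 'a) \<Rightarrow> int \<Rightarrow> 'a \<Rightarrow> 'a" where
  "int_pow A n = (if 0 \<le> n then A ^^ nat n else inv A ^^ nat (- n))"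

lemma bij_dilation: "bij dilation"
proof (rule bijI)
  show "inj dilation"
  proof (rule injI, transfer)
    fix f g :: "real \<Rightarrow> complex"
    assume "square_integrable f \<and> square_integrable f \<and> (AE x in lebesgue. f x = f x)"
      and "square_integrable g \<and> square_integrable g \<and> (AE x in lebesgue. g x = g x)"
      and "square_integrable (\<lambda>x. complex_of_real (sqrt 2) * f (2 * x)) \<and>
        square_integrable (\<lambda>x. complex_of_real (sqrt 2) * g (2 * x)) \<and>
        (AE x in lebesgue. complex_of_real (sqrt 2) * f (2 * x) = complex_of_real (sqrt 2) * g (2 * x))"
    then show "square_integrable f \<and> square_integrable g \<and> (AE x in lebesgue. f x = g x)"
      using AE_lebesgue_affine[of "\<lambda>x. f (2 * x) = g (2 * x)" "1/2" 0] by simp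
  qed
  have "\<exists>f. g = dilation f" for g
  proof transfer
    fix g :: "real \<Rightarrow> complex"
    assume g: "square_integrable g \<and> square_integrable g \<and> (AE x in lebesgue. g x = g x)"
    let ?f = "\<lambda>x. complex_of_real (1 / sqrt 2) * g (0 + (1/2) * x)"
    have sf: "square_integrable ?f"
      using g by (intro square_integrable_scale square_integrable_affine) auto
    have eq: "(\<lambda>x. complex_of_real (sqrt 2) * ?f (2 * x)) = g"
      by (simp flip: mult.assoc of_real_mult)
    have "square_integrable g \<and> square_integrable (\<lambda>x. complex_of_real (sqrt 2) * ?f (2 * x)) \<and>
        (AE x in lebesgue. g x = complex_of_real (sqrt 2) * ?f (2 * x))"
      unfolding fun_cong[OF eq] eq using g by simp
    with sf show "\<exists>f\<in>{f. square_integrable f \<and> square_integrable f \<and> (AE x in lebesgue. f x = f x)}.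
        square_integrable g \<and> square_integrable (\<lambda>x. complex_of_real (sqrt 2) * f (2 * x)) \<and>
        (AE x in lebesgue. g x = complex_of_real (sqrt 2) * f (2 * x))"
      by (intro bexI[of _ ?f]) auto
  qed
  then show "surj dilation"
    by (auto simp: surj_def)
qed

lemma translation_translation: "translation \<alpha> (translation \<beta> f) = translation (\<alpha> + \<beta>) f"
proof transfer
  fix \<alpha> \<beta> :: real and f :: "real \<Rightarrow> complex"
  assume "square_integrable f \<and> square_integrable f \<and> (AE x in lebesgue. f x = f x)"
  then show "square_integrable (\<lambda>x. f (x - \<alpha> - \<beta>)) \<and> square_integrable (\<lambda>x. f (x - (\<alpha> + \<beta>))) \<and>
      (AE x in lebesgue. f (x - \<alpha> - \<beta>) = f (x - (\<alpha> + \<beta>)))"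
    using square_integrable_affine[of f 1 "- (\<alpha> + \<beta>)"] by (simp add: algebra_simps)
qed

lemma translation_zero: "translation 0 f = f"
  by transfer simp

lemma bij_translation: "bij (translation \<alpha>)"
  by (rule o_bij[of "translation (- \<alpha>)"])
     (auto simp: translation_translation translation_zero)

definition orthonormal_basis :: "('i \<Rightarrow> L2) \<Rightarrow> bool" where
  "orthonormal_basis e \<longleftrightarrow>
     (\<forall>i j. cinner (e i) (e j) = (if i = j then 1 else 0)) \<and> closure (cspan (range e)) = UNIV"

definition wavelet :: "L2 \<Rightarrow> bool" where
  "wavelet \<psi> \<longleftrightarrow>
     orthonormal_basis (\<lambda>(n, l). int_pow dilation n (int_pow (translation 1) l \<psi>))"

definition core_space :: "L2 \<Rightarrow> L2 set" where
  "core_space \<psi> =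
     closure (cspan {int_pow dilation m (int_pow (translation 1) l \<psi>) | m l. m < 0})"

definition wavelet_space :: "L2 \<Rightarrow> L2 set" where
  "wavelet_space \<psi> = closure (cspan {int_pow (translation 1) l \<psi> | l. True})"

definition dyadic_translations :: "nat \<Rightarrow> (L2 \<Rightarrow> L2) set" where
  "dyadic_translations n = {translation (of_int m / 2 ^ n) | m :: int. True}"

definition invariant_under :: "L2 set \<Rightarrow> (L2 \<Rightarrow> L2) set \<Rightarrow> bool" where
  "invariant_under V G \<longleftrightarrow> (\<forall>A\<in>G. A ` V \<subseteq> V)"

end

theory Submission
  imports Defs
begin

text \<open>
  Write \<open>e (m, l) = D\<^sup>m T\<^sup>l \<psi>\<close>. For a set \<open>A\<close> of indices, the closed span of the \<open>e i\<close> with \<open>i \<in> A\<close>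
  is the orthogonal complement of the \<open>e i\<close> with \<open>i \<notin> A\<close>; so membership in \<open>V\<^sub>0\<close> and in \<open>W\<^sub>0\<close> is a
  family of orthogonality conditions, and adjoints move a translation from one side of the inner
  product to the other. As \<open>T\<^sub>\<alpha> D = D T\<^bsub>2\<alpha>\<^esub>\<close>, the spaces \<open>D\<^sup>k W\<^sub>0\<close> with \<open>k \<ge> 0\<close> inherit the invariance of
  \<open>W\<^sub>0\<close>, hence so does the complement \<open>V\<^sub>0\<close> of their sum. Conversely, \<open>D V\<^sub>0\<close> inherits the
  invariance of \<open>V\<^sub>0\<close>, and \<open>W\<^sub>0\<close> is the complement of \<open>V\<^sub>0\<close> in \<open>D V\<^sub>0\<close>.
\<close>

lemma cinner_eq_zero_commute: "cinner f g = 0 \<longleftrightarrow> cinner g f = 0"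
  by (subst cinner_commute) simp

lemma cinner_diff_left: "cinner (f - g) h = cinner f h - cinner g h"
  using cinner_add_left[of "f - g" g h] by simp

text \<open>Multiplying by \<open>\<i>\<close> turns the imaginary part into a real part up to sign,
  so complex orthogonality becomes two real conditions, open to the continuity rules for
  \<open>inner\<close>.\<close>

lemma cinner_eq_zero_iff_inner: "cinner f g = 0 \<longleftrightarrow> inner f g = 0 \<and> inner (scaleC \<i> f) g = 0"
  by (auto simp: inner_L2_def cinner_scaleC_left complex_eq_iff)

lemma cinner_scaleC_right: "cinner f (scaleC c g) = cnj c * cinner f g"
  by (subst (1 2) cinner_commute) (simp add: cinner_scaleC_left)

lemma inner_scaleC_left: "inner (scaleC c f) g = inner f (scaleC (cnj c) g)"
  by (simp only: inner_L2_def cinner_scaleC_left cinner_scaleC_right complex_cnj_cnj)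

text \<open>Once the scalar sits on the fixed vector \<open>g\<close>, both real conditions are
  visibly continuous in \<open>f\<close>.\<close>

lemma closed_cinner_eq_zero: "closed {f. cinner f g = 0}"
  unfolding cinner_eq_zero_iff_inner inner_scaleC_left
  by (intro closed_Collect_conj closed_Collect_eq continuous_intros)

lemma cinner_closure_cspan_eq_zero:
  assumes "\<And>g. g \<in> S \<Longrightarrow> cinner g h = 0" and "f \<in> closure (cspan S)"
  shows "cinner f h = 0"
proof -
  have "cspan S \<subseteq> {f. cinner f h = 0}"
  proof (rule complex_L2.span_minimal)
    show "complex_L2.subspace {f. cinner f h = 0}"
      using cinner_scaleC_left[of 0 0 h]
      by (auto simp: complex_L2.subspace_def cinner_add_left cinner_scaleC_left)
  qed (use assms(1) in auto)
  then show ?thesis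
    using closure_minimal[OF _ closed_cinner_eq_zero] assms(2) by blast
qed

lemma cinner_closure_cspan_right_eq_zero:
  assumes "\<And>g. g \<in> S \<Longrightarrow> cinner h g = 0" and "f \<in> closure (cspan S)"
  shows "cinner h f = 0"
  using cinner_closure_cspan_eq_zero[OF _ assms(2), of h] assms(1)
  by (simp add: cinner_eq_zero_commute[of _ h])

text \<open>An approximant of \<open>f\<close> from the full span splits into a part
  \<open>u\<close> over \<open>A\<close> and a part \<open>v\<close> over the complement. If
  \<open>f\<close> is orthogonal to the complement, dropping \<open>v\<close> does not increase the
  distance to \<open>f\<close>.\<close>

lemma closure_cspan_eq_orthogonal:
  assumes e: "orthonormal_basis e"
  shows "closure (cspan (e ` A)) = {f. \<forall>i. i \<notin> A \<longrightarrow> cinner f (e i) = 0}"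
proof -
  have perp: "cinner f (e i) = 0" if "i \<notin> A" "f \<in> closure (cspan (e ` A))" for f i
    by (rule cinner_closure_cspan_eq_zero[OF _ that(2)])
       (use e that(1) in \<open>auto simp: orthonormal_basis_def\<close>)
  show ?thesis
  proof (intro equalityI subsetI CollectI allI impI)
    fix f i assume "f \<in> closure (cspan (e ` A))" "i \<notin> A"
    then show "cinner f (e i) = 0"
      by (rule perp[rotated])
  next
    fix f assume "f \<in> {f. \<forall>i. i \<notin> A \<longrightarrow> cinner f (e i) = 0}"
    then have f: "cinner f (e i) = 0" if "i \<notin> A" for i
      using that by blast
    have "f \<in> closure (cspan (e ` A \<union> e ` (- A)))"
      using e by (simp add: orthonormal_basis_def flip: image_Un)
    show "f \<in> closure (cspan (e ` A))"
      unfolding closure_approachable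
    proof (intro allI impI)
      fix \<epsilon> :: real assume "\<epsilon> > 0"
      then obtain s where s: "s \<in> cspan (e ` A \<union> e ` (- A))" "dist s f < \<epsilon>"
        using \<open>f \<in> closure (cspan (e ` A \<union> e ` (- A)))\<close> by (auto simp: closure_approachable)
      then obtain u v where uv: "s = u + v" "u \<in> cspan (e ` A)" "v \<in> cspan (e ` (- A))"
        by (auto simp: complex_L2.span_Un)
      have "cinner u (e i) = 0" if "i \<notin> A" for i
        by (rule perp[OF that subsetD[OF closure_subset uv(2)]])
      \<comment> \<open>Both \<open>u\<close> and \<open>f\<close> are orthogonal to the vectors
        spanning \<open>v\<close>, so Pythagoras applies to
        \<open>s - f = (u - f) + v\<close>.\<close>
      then have "cinner (e i) (u - f) = 0" if "i \<notin> A" for i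
        using that f by (subst cinner_eq_zero_commute) (simp add: cinner_diff_left)
      then have "cinner v (u - f) = 0"
        by (intro cinner_closure_cspan_eq_zero[OF _ subsetD[OF closure_subset uv(3)]]) auto
      then have "orthogonal (u - f) v"
        by (subst orthogonal_commute) (simp add: orthogonal_def inner_L2_def)
      then have "(norm (u - f))\<^sup>2 \<le> (norm (s - f))\<^sup>2"
        using norm_add_Pythagorean[of "u - f" v] by (simp add: uv(1) algebra_simps)
      then have "dist u f < \<epsilon>"
        using s(2) by (simp add: dist_norm)
      then show "\<exists>y\<in>cspan (e ` A). dist y f < \<epsilon>"
        using uv(2) by blast
    qed
  qed
qed

text \<open>The two factors \<open>sqrt 2\<close> absorb the Jacobian 2 of the substitution.\<close>

lemma cinner_dilation: "cinner (dilation f) (dilation g) = cinner f g"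
proof transfer
  fix f g :: "real \<Rightarrow> complex"
  have sqrt2: "complex_of_real (sqrt 2) * complex_of_real (sqrt 2) = 2"
    by (simp flip: of_real_mult)
  have eq: "complex_of_real (sqrt 2) * z * cnj (complex_of_real (sqrt 2) * w) = 2 * (z * cnj w)"
    for z w
    unfolding sqrt2[symmetric] by simp
  have "(LINT x|lebesgue. f x * cnj (g x)) = 2 * (LINT x|lebesgue. f (2 * x) * cnj (g (2 * x)))"
    using lebesgue_integral_real_affine[of 2 "\<lambda>x. f x * cnj (g x)" 0]
    by (simp add: scaleR_conv_of_real)
  also have "\<dots> = (LINT x|lebesgue. complex_of_real (sqrt 2) * f (2 * x) *
      cnj (complex_of_real (sqrt 2) * g (2 * x)))"
    by (simp only: eq integral_mult_right_zero)
  finally show "(LINT x|lebesgue. complex_of_real (sqrt 2) * f (2 * x) *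
      cnj (complex_of_real (sqrt 2) * g (2 * x))) = (LINT x|lebesgue. f x * cnj (g x))" ..
qed

lemma cinner_translation: "cinner (translation \<alpha> f) (translation \<alpha> g) = cinner f g"
proof transfer
  fix \<alpha> :: real and f g :: "real \<Rightarrow> complex"
  show "(LINT x|lebesgue. f (x - \<alpha>) * cnj (g (x - \<alpha>))) = (LINT x|lebesgue. f x * cnj (g x))"
    using lebesgue_integral_real_affine[of 1 "\<lambda>x. f x * cnj (g x)" "- \<alpha>"] by simp
qed

lemma cinner_translation_left: "cinner (translation \<alpha> f) g = cinner f (translation (- \<alpha>) g)"
  using cinner_translation[of \<alpha> f "translation (- \<alpha>) g"]
  by (simp add: translation_translation translation_zero)

lemma cinner_dilation_funpow: "cinner ((dilation ^^ k) f) ((dilation ^^ k) g) = cinner f g"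
  by (induction k) (simp_all add: cinner_dilation)

lemma translation_dilation: "translation \<alpha> (dilation f) = dilation (translation (2 * \<alpha>) f)"
proof transfer
  fix \<alpha> :: real and f :: "real \<Rightarrow> complex"
  assume "square_integrable f \<and> square_integrable f \<and> (AE x in lebesgue. f x = f x)"
  then show "square_integrable (\<lambda>x. complex_of_real (sqrt 2) * f (2 * (x - \<alpha>))) \<and>
      square_integrable (\<lambda>x. complex_of_real (sqrt 2) * f (2 * x - 2 * \<alpha>)) \<and>
      (AE x in lebesgue. complex_of_real (sqrt 2) * f (2 * (x - \<alpha>)) =
        complex_of_real (sqrt 2) * f (2 * x - 2 * \<alpha>))"
    using square_integrable_affine[of f 2 "- (2 * \<alpha>)"]
    by (auto simp: algebra_simps intro!: square_integrable_scale)
qed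

lemma translation_dilation_funpow:
  "translation \<alpha> ((dilation ^^ k) f) = (dilation ^^ k) (translation (2 ^ k * \<alpha>) f)"
  by (induction k arbitrary: \<alpha>) (simp_all add: translation_dilation mult_ac)

lemma int_pow_zero: "int_pow A 0 f = f"
  by (simp add: int_pow_def)

theorem theorem2:
  fixes \<psi> :: L2 and n :: nat
  assumes "wavelet \<psi>"
  shows "invariant_under (core_space \<psi>) (dyadic_translations n) \<longleftrightarrow>
         invariant_under (wavelet_space \<psi>) (dyadic_translations n)"
proof -
  define e where "e = (\<lambda>(n, l). int_pow dilation n (int_pow (translation 1) l \<psi>))"
  define \<alpha> :: "int \<Rightarrow> real" where "\<alpha> k = of_int k / 2 ^ n" for k
  have basis: "orthonormal_basis e"
    using assms by (simp add: wavelet_def e_def)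
  have e_Suc: "e (int (Suc k), l) = dilation (e (int k, l))" for k l
    by (simp add: e_def int_pow_def nat_add_distrib del: of_nat_Suc)
  have e_nat: "e (int k, l) = (dilation ^^ k) (e (0, l))" for k l
    by (simp add: e_def int_pow_def)
  have "{int_pow dilation m (int_pow (translation 1) l \<psi>) |m l. m < 0} = e ` {(m, l). m < 0}"
    by (auto simp: e_def image_iff)
  then have V_closure: "core_space \<psi> = closure (cspan (e ` {(m, l). m < 0}))"
    by (simp add: core_space_def)
  have "{int_pow (translation 1) l \<psi> |l. True} = e ` {(m, l). m = 0}"
    by (auto simp: e_def int_pow_zero image_iff)
  then have W_closure: "wavelet_space \<psi> = closure (cspan (e ` {(m, l). m = 0}))"
    by (simp add: wavelet_space_def)
  have V_iff: "f \<in> core_space \<psi> \<longleftrightarrow> (\<forall>k l. cinner f (e (int k, l)) = 0)" for f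
    unfolding V_closure closure_cspan_eq_orthogonal[OF basis]
    by (auto simp: not_less) (metis nonneg_int_cases)
  have W_iff: "f \<in> wavelet_space \<psi> \<longleftrightarrow> (\<forall>m l. m \<noteq> 0 \<longrightarrow> cinner f (e (m, l)) = 0)" for f
    unfolding W_closure closure_cspan_eq_orthogonal[OF basis] by auto
  have e_V: "e (m, l) \<in> core_space \<psi>" if "m < 0" for m l
    unfolding V_closure using that by (auto intro!: closure_subset[THEN subsetD] complex_L2.span_base)
  have e_W: "e (0, l) \<in> wavelet_space \<psi>" for l
    unfolding W_closure by (auto intro!: closure_subset[THEN subsetD] complex_L2.span_base)
  have W_perp_V: "cinner f g = 0" if "f \<in> wavelet_space \<psi>" "g \<in> core_space \<psi>" for f g
    by (rule cinner_closure_cspan_right_eq_zero[OF _ that(2)[unfolded V_closure]])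
       (use that(1) in \<open>auto simp: W_iff\<close>)
  have perp_W: "cinner f g = 0" if "g \<in> wavelet_space \<psi>" "\<And>l. cinner f (e (0, l)) = 0" for f g
    by (rule cinner_closure_cspan_right_eq_zero[OF _ that(1)[unfolded W_closure]])
       (use that(2) in auto)
  have invariant_iff: "invariant_under X (dyadic_translations n) \<longleftrightarrow>
      (\<forall>k. \<forall>f\<in>X. translation (\<alpha> k) f \<in> X)" for X
    by (auto simp: invariant_under_def dyadic_translations_def \<alpha>_def)
  \<comment> \<open>Negation serves the adjoints, powers of 2 the exchange of translations with
    dilations; both stay among the shifts \<open>\<alpha> k\<close>.\<close>
  have \<alpha>_minus: "- \<alpha> k = \<alpha> (- k)" and \<alpha>_mult: "2 ^ j * \<alpha> k = \<alpha> (2 ^ j * k)" for j k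
    by (simp_all add: \<alpha>_def)
  show ?thesis
    unfolding invariant_iff
  proof (intro iffI allI ballI)
    fix k f
    assume V: "\<forall>k. \<forall>f\<in>core_space \<psi>. translation (\<alpha> k) f \<in> core_space \<psi>"
      and f: "f \<in> wavelet_space \<psi>"
    \<comment> \<open>Pairing \<open>g\<close> with scale \<open>j\<close> equals pairing
      \<open>f\<close> with scale \<open>j + 1\<close>, which is never 0, so \<open>g\<close> lies
      in the core space.\<close>
    obtain g where g: "f = dilation g"
      using bij_dilation by (metis bij_pointE)
    have gV: "g \<in> core_space \<psi>"
      unfolding V_iff
    proof (intro allI)
      fix j l
      show "cinner g (e (int j, l)) = 0"
        using f cinner_dilation[of g "e (int j, l)"]
        by (simp add: W_iff g flip: e_Suc del: of_nat_Suc)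
    qed
    show "translation (\<alpha> k) f \<in> wavelet_space \<psi>"
      unfolding W_iff
    proof (intro allI impI)
      fix m l :: int assume "m \<noteq> 0"
      then consider "m < 0" | j where "m = int (Suc j)"
        by (metis int_cases2 linorder_cases nonneg_int_cases not0_implies_Suc of_nat_0 order_less_imp_le)
      then show "cinner (translation (\<alpha> k) f) (e (m, l)) = 0"
      proof cases
        \<comment> \<open>The adjoint translation keeps \<open>e (m, l)\<close> in the core space,
          to which \<open>f\<close> is orthogonal.\<close>
        case 1
        then show ?thesis
          using V e_V W_perp_V[OF f] by (simp add: cinner_translation_left \<alpha>_minus)
      next
        \<comment> \<open>Cancelling one dilation leaves a translate of \<open>g\<close>, again in
          the core space, paired with scale \<open>j\<close>.\<close>
        case 2
        have "translation (\<alpha> k) f = dilation (translation (\<alpha> (2 * k)) g)"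
          using \<alpha>_mult[of 1 k] by (simp add: g translation_dilation)
        then show ?thesis
          using V gV by (simp add: 2 e_Suc cinner_dilation V_iff del: of_nat_Suc)
      qed
    qed
  next
    fix k f
    assume W: "\<forall>k. \<forall>f\<in>wavelet_space \<psi>. translation (\<alpha> k) f \<in> wavelet_space \<psi>"
      and f: "f \<in> core_space \<psi>"
    show "translation (\<alpha> k) f \<in> core_space \<psi>"
      unfolding V_iff
    proof (intro allI)
      fix j l
      \<comment> \<open>Undoing \<open>j\<close> dilations brings scale \<open>j\<close> down to
        scale 0, so \<open>g\<close> is orthogonal to all of the wavelet space.\<close>
      obtain g where g: "f = (dilation ^^ j) g"
        using bij_dilation by (metis bij_fn bij_pointE)
      have "cinner g (e (0, l)) = 0" for l
        using f cinner_dilation_funpow[of j g] unfolding V_iff g e_nat by metis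
      \<comment> \<open>This is the adjoint translation after it has passed \<open>j\<close>
        dilations; its shift is still dyadic of level \<open>n\<close>, so \<open>W\<close>
        applies.\<close>
      moreover have "translation (2 ^ j * - \<alpha> k) (e (0, l)) \<in> wavelet_space \<psi>"
        using W e_W by (simp only: \<alpha>_minus \<alpha>_mult)
      ultimately have "cinner g (translation (2 ^ j * - \<alpha> k) (e (0, l))) = 0"
        by (rule perp_W[rotated])
      then show "cinner (translation (\<alpha> k) f) (e (int j, l)) = 0"
        by (simp add: cinner_translation_left e_nat g translation_dilation_funpow
            cinner_dilation_funpow)
    qed
  qed
qed

end
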